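(* Let $f:\mathbb{R}^n\to\mathbb{R}$ be differentiable and let $A$ be a real $m\times n$ matrix such that for all $x,h\in\mathbb{R}^n$, $$f(x+h)\le f(x)+\langle\nabla f(x),h\rangle+\tfrac12 h^\top A^\top A h .$$ For $j\in\{1,\dots,m\}$ let $J_j=\{i\in[n]:A_{ji}\ne0\}$. Let $\hat S$ be an arbitrary sampling of $[n]$ and let $v=(v_1,\dots,v_n)$ be defined by $$v_i=\sum_{j=1}^m\lambda'(J_j\cap\hat S)\,A_{ji}^2,\qquad i=1,2,\dots,n.$$ Then $(f,\hat S)\sim ESO(v)$.
   Context: Let $[n]=\{1,\dots,n\}$. A sampling $\hat S$ is a random subset of $[n]$; $p_i=\mathbf{P}(i\in\hat S)$. For $J\subseteq[n]$, $J\cap\hat S$ is the sampling (random set) obtained by intersecting $\hat S$ with $J$. The probability matrix $P(\hat S)$ is the $n\times n$ positive semidefinite matrix with entries $P(\hat S)_{ij}=\mathbf{P}(\{i,j\}\subseteq\hat S)$. For an $n\times n$ positive semidefinite matrix $M$, $\lambda'(M)=\max_{h\in\mathbb{R}^n}\{h^\top M h: h^\top\mathrm{Diag}(M)h\le1\}$, where $\mathrm{Diag}(M)$ is the diagonal matrix containing the diagonal of $M$; for a sampling, $\lambda'(\hat S)=\lambda'(P(\hat S))$. For a differentiable $f:\mathbb{R}^n\to\mathbb{R}$ and a sampling $\hat S$, one says that $f$ admits an expected separable overapproximation (ESO) with respect to $\hat S$ with parameters $v=(v_1,\dots,v_n)>0$ (all entries positive), written $(f,\hat S)\sim ESO(v)$,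 if for all $x,h\in\mathbb{R}^n$, $$\mathbf{E}\Big[f\Big(x+\sum_{i\in\hat S}h_ie_i\Big)\Big]\le f(x)+\sum_{i=1}^n p_i\,\nabla_i f(x)\,h_i+\frac12\sum_{i=1}^n p_iv_ih_i^2,$$ where $e_i$ is the $i$-th standard basis vector and $\nabla_i f$ the $i$-th partial derivative.
   Formalization: The ESO inequality is proved for every A and every sampling, but ESO(v), which includes v > 0, is concluded only when all v_i > 0; as stated the claim fails, e.g. for f = 0, A = 0, where v = 0. *)

theory Defs
  imports "HOL-Analysis.Analysis" "HOL-Probability.Probability"
begin

text \<open>The index set $[n]$ is a finite type \<open>'n\<close>. A sampling enters only through its
  distribution on the finite set of subsets of $[n]$, so it is given as a pmf.\<close>

type_synonym 'n sampling = "'n set pmf"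

definition incl_prob :: "'n sampling \<Rightarrow> 'n \<Rightarrow> real"
  where "incl_prob S i = measure_pmf.prob S {T. i \<in> T}"

definition restrict_sampling :: "'n set \<Rightarrow> 'n sampling \<Rightarrow> 'n sampling"
  where "restrict_sampling J S = map_pmf (\<lambda>T. J \<inter> T) S"

definition prob_matrix :: "'n::finite sampling \<Rightarrow> real^'n^'n"
  where "prob_matrix S = (\<chi> i j. measure_pmf.prob S {T. {i, j} \<subseteq> T})"

definition Diag :: "real^'n^'n \<Rightarrow> real^'n^'n"
  where "Diag M = (\<chi> i j. if i = j then M $ i $ j else 0)"

text \<open>For positive semidefinite \<open>M\<close> the supremum is a maximum: a zero diagonal entry forces the
  corresponding row and column to vanish, so the problem reduces to a compact ellipsoid.
  It is only meant to be used for such \<open>M\<close>.\<close>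

definition lambda_prime :: "real^'n::finite^'n \<Rightarrow> real"
  where "lambda_prime M = Sup {h \<bullet> (M *v h) | h. h \<bullet> (Diag M *v h) \<le> 1}"

definition lambda_prime_sampling :: "'n::finite sampling \<Rightarrow> real"
  where "lambda_prime_sampling S = lambda_prime (prob_matrix S)"

definition partial_deriv :: "(real^'n::finite \<Rightarrow> real) \<Rightarrow> 'n \<Rightarrow> real^'n \<Rightarrow> real"
  where "partial_deriv f i x = deriv (\<lambda>t. f (x + t *\<^sub>R axis i 1)) 0"

definition gradient :: "(real^'n::finite \<Rightarrow> real) \<Rightarrow> real^'n \<Rightarrow> real^'n"
  where "gradient f x = (\<chi> i. partial_deriv f i x)"

definition ESO_inequality ::
  "(real^'n::finite \<Rightarrow> real) \<Rightarrow> 'n sampling \<Rightarrow> real^'n \<Rightarrow> bool"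
  where "ESO_inequality f S v \<longleftrightarrow>
    (\<forall>x h. measure_pmf.expectation S (\<lambda>T. f (x + (\<Sum>i\<in>T. h $ i *\<^sub>R axis i 1)))
       \<le> f x + (\<Sum>i\<in>UNIV. incl_prob S i * partial_deriv f i x * h $ i)
         + 1/2 * (\<Sum>i\<in>UNIV. incl_prob S i * v $ i * (h $ i)\<^sup>2))"

text \<open>An ESO requires positive parameters; the inequality alone also makes sense for parameters
  with zero entries, which arise e.g. from a zero column of the data matrix.\<close>

definition ESO :: "(real^'n::finite \<Rightarrow> real) \<Rightarrow> 'n sampling \<Rightarrow> real^'n \<Rightarrow> bool"
  where "ESO f S v \<longleftrightarrow> (\<forall>i. 0 < v $ i) \<and> ESO_inequality f S v"

end

theory Submission imports Defs begin

text \<open>Evaluate the quadratic upper bound on \<open>f\<close> at the random step \<open>\<Sum>i\<in>T. h $ i *\<^sub>R axis i 1\<close> and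
  take expectations. The linear term contributes \<open>\<Sum>i. p\<^sub>i \<nabla>\<^sub>i f(x) h\<^sub>i\<close> exactly, by linearity, so
  everything lies in the quadratic term. There the norm of \<open>A\<close> times the step splits into rows: row
  \<open>j\<close> contributes the square of \<open>\<Sum>i\<in>T. A\<^sub>j\<^sub>i h\<^sub>i\<close>, and only the indices in \<open>J\<^sub>j \<inter> T\<close> matter in this
  sum. Its expected square is therefore the quadratic form of the probability matrix of \<open>J\<^sub>j \<inter> S\<close> at
  the vector \<open>(A\<^sub>j\<^sub>i h\<^sub>i)\<^sub>i\<close>.

  By homogeneity \<open>\<lambda>'\<close> bounds such a form by \<open>\<lambda>'\<close> times the diagonal form (lemma
  \<open>sampling_form_le_lambda_prime\<close>), here
  \<open>\<lambda>'(J\<^sub>j \<inter> S) \<Sum>i. p\<^sub>i A\<^sub>j\<^sub>i\<^sup>2 h\<^sub>i\<^sup>2\<close>; summing over \<open>j\<close> gives \<open>\<Sum>i. p\<^sub>i v\<^sub>i h\<^sub>i\<^sup>2\<close>. Since \<open>\<lambda>'\<close> is a supremum,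
  homogeneity can only be used once the form is known to be bounded on the feasible set; for
  a sampling, Cauchy-Schwarz gives the bound \<open>n\<close>, which also settles vectors with vanishing
  diagonal form, where normalisation is impossible.\<close>

lemma integrable_sampling [simp]:
  fixes S :: "'n::finite sampling" and g :: "'n set \<Rightarrow> real"
  shows "integrable (measure_pmf S) g"
  by (rule integrable_measure_pmf_finite) simp

lemma expectation_sum_sampled:
  fixes S :: "'n::finite sampling" and g :: "'n \<Rightarrow> real"
  shows "measure_pmf.expectation S (\<lambda>T. \<Sum>i\<in>T. g i) = (\<Sum>i\<in>UNIV. incl_prob S i * g i)"
proof -
  have eq: "(\<Sum>i\<in>T. g i) = (\<Sum>i\<in>UNIV. indicator {T. i \<in> T} T * g i)" for T :: "'n set"
    by (intro sum.mono_neutral_cong_left) (auto simp: indicator_def)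
  show ?thesis
    unfolding eq by (simp add: incl_prob_def del: sum_indicator_mult)
qed

lemma inner_mult_vec_eq_double_sum:
  fixes M :: "real^'n::finite^'n"
  shows "g \<bullet> (M *v g) = (\<Sum>i\<in>UNIV. \<Sum>j\<in>UNIV. M $ i $ j * (g $ i * g $ j))"
  by (simp add: inner_vec_def matrix_vector_mult_def sum_distrib_left mult.assoc mult.left_commute)

lemma prob_matrix_form:
  fixes S :: "'n::finite sampling"
  shows "g \<bullet> (prob_matrix S *v g) = measure_pmf.expectation S (\<lambda>T. (\<Sum>i\<in>T. g $ i)\<^sup>2)"
proof -
  have eq: "(\<Sum>i\<in>T. g $ i)\<^sup>2 =
      (\<Sum>i\<in>UNIV. \<Sum>j\<in>UNIV. indicator {T. {i, j} \<subseteq> T} T * (g $ i * g $ j))" for T :: "'n set"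
  proof -
    have "(\<Sum>i\<in>T. g $ i)\<^sup>2 = (\<Sum>i\<in>T. \<Sum>j\<in>T. g $ i * g $ j)"
      by (simp add: power2_eq_square sum_product)
    also have "\<dots> = (\<Sum>i\<in>T. \<Sum>j\<in>UNIV. indicator {T. {i, j} \<subseteq> T} T * (g $ i * g $ j))"
      by (intro sum.cong refl sum.mono_neutral_cong_left) (auto simp: indicator_def)
    also have "\<dots> = (\<Sum>i\<in>UNIV. \<Sum>j\<in>UNIV. indicator {T. {i, j} \<subseteq> T} T * (g $ i * g $ j))"
      by (intro sum.mono_neutral_left) (auto simp: indicator_def)
    finally show ?thesis .
  qed
  show ?thesis
    unfolding eq inner_mult_vec_eq_double_sum
    by (simp add: prob_matrix_def del: sum_indicator_mult insert_subset)
qed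

lemma Diag_prob_matrix_form:
  fixes S :: "'n::finite sampling"
  shows "g \<bullet> (Diag (prob_matrix S) *v g) = (\<Sum>i\<in>UNIV. incl_prob S i * (g $ i)\<^sup>2)"
  by (simp add: inner_mult_vec_eq_double_sum Diag_def prob_matrix_def incl_prob_def
      if_distrib[where f="\<lambda>x. x * _"] power2_eq_square cong: if_cong)

text \<open>The domination hypothesis makes the set in the definition of \<open>lambda_prime\<close> bounded, so
  that the supremum is a genuine upper bound, and it forces the form to be nonpositive where the
  diagonal form is not positive. Everywhere else, \<open>h\<close> can be normalised.\<close>

lemma form_le_lambda_prime:
  fixes M :: "real^'n::finite^'n"
  assumes dom: "\<And>h. h \<bullet> (M *v h) \<le> c * (h \<bullet> (Diag M *v h))"
    and nonneg: "\<And>h. 0 \<le> h \<bullet> (Diag M *v h)"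
  shows "h \<bullet> (M *v h) \<le> lambda_prime M * (h \<bullet> (Diag M *v h))"
proof (cases "h \<bullet> (Diag M *v h) = 0")
  case True
  then show ?thesis using dom[of h] by simp
next
  case False
  define d where "d = h \<bullet> (Diag M *v h)"
  have d: "d > 0" using False nonneg[of h] by (simp add: d_def)
  define u where "u = (1 / sqrt d) *\<^sub>R h"
  have form_u: "u \<bullet> (N *v u) = (h \<bullet> (N *v h)) / d" for N :: "real^'n^'n"
    using d by (simp add: u_def matrix_vector_mult_scaleR)
  have "k \<bullet> (M *v k) \<le> \<bar>c\<bar>" if "k \<bullet> (Diag M *v k) \<le> 1" for k
  proof -
    have "c * (k \<bullet> (Diag M *v k)) \<le> \<bar>c\<bar> * 1"
      using that nonneg[of k] by (intro mult_mono) auto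
    then show ?thesis using dom[of k] by simp
  qed
  then have "bdd_above {k \<bullet> (M *v k) | k. k \<bullet> (Diag M *v k) \<le> 1}"
    by (intro bdd_aboveI[of _ "\<bar>c\<bar>"]) auto
  moreover have "u \<bullet> (Diag M *v u) \<le> 1"
    using d by (simp add: form_u d_def)
  ultimately have "u \<bullet> (M *v u) \<le> lambda_prime M"
    unfolding lambda_prime_def by (intro cSup_upper) auto
  then show ?thesis
    using d by (simp add: form_u d_def[symmetric] field_simps)
qed

lemma sampling_form_le_lambda_prime:
  fixes S :: "'n::finite sampling"
  shows "g \<bullet> (prob_matrix S *v g)
    \<le> lambda_prime_sampling S * (\<Sum>i\<in>UNIV. incl_prob S i * (g $ i)\<^sup>2)"
proof -
  have "h \<bullet> (prob_matrix S *v h) \<le> real CARD('n) * (h \<bullet> (Diag (prob_matrix S) *v h))"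
    for h :: "real^'n"
  proof -
    have "(\<Sum>i\<in>T. h $ i)\<^sup>2 \<le> real CARD('n) * (\<Sum>i\<in>T. (h $ i)\<^sup>2)" for T :: "'n set"
    proof -
      have "(\<Sum>i\<in>T. h $ i)\<^sup>2 \<le> (\<Sum>i\<in>T. (h $ i)\<^sup>2) * real (card T)"
        using Cauchy_Schwarz_ineq_sum[of "\<lambda>i. h $ i" "\<lambda>_. 1" T] by simp
      also have "\<dots> \<le> (\<Sum>i\<in>T. (h $ i)\<^sup>2) * real CARD('n)"
        by (intro mult_left_mono sum_nonneg) (auto simp: card_mono)
      finally show ?thesis by (simp add: mult.commute)
    qed
    then have "measure_pmf.expectation S (\<lambda>T. (\<Sum>i\<in>T. h $ i)\<^sup>2)
        \<le> measure_pmf.expectation S (\<lambda>T. real CARD('n) * (\<Sum>i\<in>T. (h $ i)\<^sup>2))"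
      by (intro integral_mono) auto
    then show ?thesis
      by (simp add: prob_matrix_form Diag_prob_matrix_form expectation_sum_sampled)
  qed
  moreover have "0 \<le> h \<bullet> (Diag (prob_matrix S) *v h)" for h :: "real^'n"
    by (auto simp: Diag_prob_matrix_form incl_prob_def intro!: sum_nonneg)
  ultimately show ?thesis
    unfolding lambda_prime_sampling_def Diag_prob_matrix_form[symmetric]
    by (rule form_le_lambda_prime)
qed

lemma incl_prob_restrict_sampling:
  "incl_prob (restrict_sampling J S) i = (if i \<in> J then incl_prob S i else 0)"
  by (simp add: incl_prob_def restrict_sampling_def vimage_def)

text \<open>A vector supported on \<open>J\<close> does not see the difference between \<open>S\<close> and \<open>J \<inter> S\<close>, so the constant
  of the restricted sampling, which exploits the sparsity, may be used.\<close>

lemma expectation_square_supported: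
  fixes S :: "'n::finite sampling"
  assumes supp: "\<And>i. i \<notin> J \<Longrightarrow> g $ i = 0"
  shows "measure_pmf.expectation S (\<lambda>T. (\<Sum>i\<in>T. g $ i)\<^sup>2)
    \<le> lambda_prime_sampling (restrict_sampling J S) * (\<Sum>i\<in>UNIV. incl_prob S i * (g $ i)\<^sup>2)"
proof -
  have "(\<Sum>i\<in>T. g $ i) = (\<Sum>i\<in>J \<inter> T. g $ i)" for T
    using supp by (intro sum.mono_neutral_right) auto
  then have "measure_pmf.expectation S (\<lambda>T. (\<Sum>i\<in>T. g $ i)\<^sup>2)
      = g \<bullet> (prob_matrix (restrict_sampling J S) *v g)"
    by (simp add: prob_matrix_form restrict_sampling_def)
  also have "\<dots> \<le> lambda_prime_sampling (restrict_sampling J S)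
      * (\<Sum>i\<in>UNIV. incl_prob (restrict_sampling J S) i * (g $ i)\<^sup>2)"
    by (rule sampling_form_le_lambda_prime)
  also have "(\<Sum>i\<in>UNIV. incl_prob (restrict_sampling J S) i * (g $ i)\<^sup>2)
      = (\<Sum>i\<in>UNIV. incl_prob S i * (g $ i)\<^sup>2)"
    using supp by (intro sum.cong) (auto simp: incl_prob_restrict_sampling)
  finally show ?thesis .
qed

lemma inner_sampled_step:
  fixes a h :: "real^'n::finite"
  shows "a \<bullet> (\<Sum>i\<in>T. h $ i *\<^sub>R axis i 1) = (\<Sum>i\<in>T. a $ i * h $ i)"
  by (simp add: inner_sum_right inner_axis mult.commute)

lemma gram_form_eq_sum_rows:
  fixes A :: "real^'n::finite^'m::finite"
  shows "y \<bullet> ((transpose A ** A) *v y) = (\<Sum>j\<in>UNIV. (A $ j \<bullet> y)\<^sup>2)"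
proof -
  have "y \<bullet> ((transpose A ** A) *v y) = (A *v y) \<bullet> (A *v y)"
    by (metis dot_lmul_matrix inner_commute matrix_vector_mul_assoc transpose_matrix_vector)
  then show ?thesis
    by (simp add: inner_vec_def[of "A *v y"] matrix_vector_mul_component power2_eq_square)
qed

theorem theorem5p2:
  fixes f :: "real^'n::finite \<Rightarrow> real"
    and A :: "real^'n^'m::finite"
    and S :: "'n sampling"
    and J :: "'m \<Rightarrow> 'n set"
    and v :: "real^'n"
  assumes "\<And>x. f differentiable (at x)"
    and "\<And>x h. f (x + h) \<le> f x + gradient f x \<bullet> h + 1/2 * (h \<bullet> ((transpose A ** A) *v h))"
    and "\<And>j. J j = {i. A $ j $ i \<noteq> 0}"
    and "\<And>i. v $ i = (\<Sum>j\<in>UNIV. lambda_prime_sampling (restrict_sampling (J j) S) * (A $ j $ i)\<^sup>2)"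
  shows "ESO_inequality f S v \<and> ((\<forall>i. 0 < v $ i) \<longrightarrow> ESO f S v)"
proof -
  have "measure_pmf.expectation S (\<lambda>T. f (x + (\<Sum>i\<in>T. h $ i *\<^sub>R axis i 1)))
       \<le> f x + (\<Sum>i\<in>UNIV. incl_prob S i * partial_deriv f i x * h $ i)
         + 1/2 * (\<Sum>i\<in>UNIV. incl_prob S i * v $ i * (h $ i)\<^sup>2)" for x h
  proof -
    define L where "L j = lambda_prime_sampling (restrict_sampling (J j) S)" for j
    define g :: "'m \<Rightarrow> real^'n" where "g j = (\<chi> i. A $ j $ i * h $ i)" for j
    have "f (x + (\<Sum>i\<in>T. h $ i *\<^sub>R axis i 1))
        \<le> f x + (\<Sum>i\<in>T. partial_deriv f i x * h $ i) + 1/2 * (\<Sum>j\<in>UNIV. (\<Sum>i\<in>T. g j $ i)\<^sup>2)" for T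
      using assms(2)[of x "\<Sum>i\<in>T. h $ i *\<^sub>R axis i 1"]
      by (simp add: gram_form_eq_sum_rows inner_sampled_step gradient_def g_def)
    then have "measure_pmf.expectation S (\<lambda>T. f (x + (\<Sum>i\<in>T. h $ i *\<^sub>R axis i 1)))
        \<le> measure_pmf.expectation S (\<lambda>T. f x + (\<Sum>i\<in>T. partial_deriv f i x * h $ i)
             + 1/2 * (\<Sum>j\<in>UNIV. (\<Sum>i\<in>T. g j $ i)\<^sup>2))"
      by (intro integral_mono) auto
    also have "\<dots> = f x + (\<Sum>i\<in>UNIV. incl_prob S i * partial_deriv f i x * h $ i)
        + 1/2 * (\<Sum>j\<in>UNIV. measure_pmf.expectation S (\<lambda>T. (\<Sum>i\<in>T. g j $ i)\<^sup>2))"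
      by (simp add: expectation_sum_sampled mult.assoc)
    also have "(\<Sum>j\<in>UNIV. measure_pmf.expectation S (\<lambda>T. (\<Sum>i\<in>T. g j $ i)\<^sup>2))
        \<le> (\<Sum>j\<in>UNIV. L j * (\<Sum>i\<in>UNIV. incl_prob S i * (g j $ i)\<^sup>2))"
      unfolding L_def
      by (intro sum_mono expectation_square_supported) (auto simp: g_def assms(3))
    also have "\<dots> = (\<Sum>i\<in>UNIV. incl_prob S i * v $ i * (h $ i)\<^sup>2)"
    proof -
      have "(\<Sum>j\<in>UNIV. L j * (\<Sum>i\<in>UNIV. incl_prob S i * (g j $ i)\<^sup>2))
          = (\<Sum>i\<in>UNIV. \<Sum>j\<in>UNIV. L j * (incl_prob S i * (g j $ i)\<^sup>2))"
        unfolding sum_distrib_left by (rule sum.swap)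
      also have "\<dots> = (\<Sum>i\<in>UNIV. incl_prob S i * v $ i * (h $ i)\<^sup>2)"
        by (intro sum.cong refl)
          (simp add: assms(4) L_def g_def sum_distrib_left sum_distrib_right power_mult_distrib mult_ac)
      finally show ?thesis .
    qed
    finally show ?thesis by simp
  qed
  then show ?thesis
    by (simp add: ESO_def ESO_inequality_def)
qed

end
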